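(* Let $k\ge2$ be an integer and $c\in(0,1)$. Let $(M_n)_{n\ge1}$ be integers with $1\le M_n\le kn-1$ and $M_n/(kn)\to c$ as $n\to\infty$. Then \[ \lim_{n\to\infty} P_{n,k}(\mathcal{S}^+(n,k;M_n))=-\big(1-(1-c)^k\big)\log\big(1-(1-c)^k\big). \]
   Context: Fix integers $k\ge2$, $n\ge1$. There are $kn$ items, $k$ items at each of the ranks $1,2,\dots,n$ (rank $n$ is highest). The items are revealed one at a time in a uniformly random order, i.e. the sequence of ranks is a uniformly random permutation of the multiset $\{1^k,2^k,\dots,n^k\}$; $P_{n,k}$ denotes this uniform probability. For $M\in\{1,\dots,kn-1\}$, the strategy $\mathcal{S}^+(n,k;M)$ lets the first $M$ items pass and then selects the first later-arriving item whose rank is strictly greater than the highest rank among the first $M$ items (if such an item exists; otherwise nothing is selected). $P_{n,k}(\mathcal{S}^+(n,k;M))$ denotes the probability that this strategy selects an item of rank $n$. *)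

theory Defs
  imports "HOL-Analysis.Analysis" "HOL-Library.Multiset"
begin

definition arrangements :: "nat \<Rightarrow> nat \<Rightarrow> nat list set" where
  "arrangements n k = {xs. mset xs = (\<Sum>r\<in>{1..n}. replicate_mset k r)}"

definition splus_succeeds :: "nat \<Rightarrow> nat \<Rightarrow> nat list \<Rightarrow> bool" where
  "splus_succeeds n M xs =
     (find (\<lambda>r. r > Max (set (take M xs))) (drop M xs) = Some n)"

definition P_splus :: "nat \<Rightarrow> nat \<Rightarrow> nat \<Rightarrow> real" where
  "P_splus n k M =
     real (card {xs \<in> arrangements n k. splus_succeeds n M xs}) / real (card (arrangements n k))"

end

theory Submission
  imports Defs "HOL-Combinatorics.Multiset_Permutations"
begin

text \<open>
  Let \<open>Q j\<close> be the probability that none of the \<open>k j\<close> items of the top \<open>j\<close> ranks is among the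
  first \<open>M\<close>. The maximum of the first \<open>M\<close> items is \<open>n - j\<close> with probability \<open>Q j - Q (j + 1)\<close>, and
  then, the top \<open>j\<close> ranks being exchangeable, the selected item has rank \<open>n\<close> with probability
  \<open>1 / j\<close>. Hence the success probability is the sum of \<open>(Q j - Q (j + 1)) / j\<close> over \<open>1 \<le> j < n\<close>.
  As \<open>Q j\<close> tends to \<open>q ^ j\<close> with \<open>q = (1 - c) ^ k\<close>, and is eventually dominated by a geometric
  sequence, Tannery's theorem and the logarithm series give the limit \<open>- (1 - q) ln (1 - q)\<close>.
\<close>

section \<open>Avoidance probability: recursion, bounds and limit\<close>

text \<open>
  The probability that \<open>t\<close> marked items all miss the first \<open>M\<close> of \<open>N\<close> positions. If \<open>N - M < t \<le> N\<close>,
  truncated subtraction produces a zero factor, as it should.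
\<close>

definition avoid_prob :: "nat \<Rightarrow> nat \<Rightarrow> nat \<Rightarrow> real" where
  "avoid_prob N M t = (\<Prod>i<t. real (N - M - i) / real (N - i))"

text \<open>Condition on the first position: it is unmarked with probability
  \<open>(N - t) / N\<close>, and the \<open>t\<close> marked items must then miss the next
  \<open>M\<close> of the remaining \<open>N - 1\<close> positions.\<close>

lemma avoid_prob_Suc:
  assumes "t \<le> N" "0 < N"
  shows "avoid_prob N (Suc M) t = real (N - t) / real N * avoid_prob (N - 1) M t"
  using assms
proof (induction t)
  case 0
  then show ?case by (simp add: avoid_prob_def)
next
  case (Suc t)
  have "avoid_prob N (Suc M) (Suc t) =
      avoid_prob (N - 1) M t * real (N - 1 - M - t) / real N"
    using Suc by (simp add: avoid_prob_def)
  also have "\<dots> = real (N - Suc t) / real N * avoid_prob (N - 1) M (Suc t)"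
    \<comment> \<open>If \<open>N - 1 - t = 0\<close>, both sides vanish; otherwise
      \<open>N - Suc t\<close> cancels the denominator of the last factor.\<close>
    by (cases "N - 1 - t = 0") (auto simp: avoid_prob_def)
  finally show ?case .
qed

lemma avoid_prob_nonneg: "avoid_prob N M t \<ge> 0"
  by (simp add: avoid_prob_def prod_nonneg)

text \<open>Lowering numerator and denominator of a fraction in [0, 1] by the same \<open>i\<close>
  cannot increase it, so every factor is at most the first one. This is the source of the geometric
  domination.\<close>

lemma avoid_prob_le_power:
  assumes "t \<le> N"
  shows "avoid_prob N M t \<le> (real (N - M) / real N) ^ t"
proof -
  have "avoid_prob N M t \<le> (\<Prod>i<t. real (N - M) / real N)"
    unfolding avoid_prob_def
  proof (rule prod_mono, safe)
    fix i assume "i < t"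
    have "real (N - M - i) * real N \<le> real (N - M) * real (N - i)"
    proof (cases "M + i \<le> N")
      case True
      then have "real (N - M - i) = real N - real M - real i" "real (N - M) = real N - real M"
        "real (N - i) = real N - real i" by auto
      then show ?thesis by (simp add: algebra_simps)
    qed simp
    then show "real (N - M - i) / real (N - i) \<le> real (N - M) / real N"
      using \<open>i < t\<close> assms by (simp add: field_simps)
  qed simp
  then show ?thesis by simp
qed

lemma avoid_prob_antimono:
  assumes "s \<le> t"
  shows "avoid_prob N M t \<le> avoid_prob N M s"
  using assms
proof (induction t rule: dec_induct)
  case (step t)
  have "real (N - M - t) / real (N - t) \<le> 1"
    \<comment> \<open>For \<open>t >= N\<close> the denominator truncates to 0 and the quotient is 0
      by convention.\<close>
    by (cases "t < N") (auto simp: divide_le_eq_1)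
  then have "avoid_prob N M t * (real (N - M - t) / real (N - t)) \<le> avoid_prob N M t"
    using avoid_prob_nonneg by (intro mult_left_le) auto
  then show ?case
    using step by (simp add: avoid_prob_def)
qed simp

text \<open>The number \<open>t\<close> of factors is fixed and each tends to \<open>1 - c\<close>:
  drawing without replacement looks independent in the limit.\<close>

lemma tendsto_avoid_prob:
  assumes N: "filterlim N at_top F"
    and lim: "((\<lambda>n. real (M n) / real (N n)) \<longlongrightarrow> c) F" and c: "c < 1"
  shows "((\<lambda>n. avoid_prob (N n) (M n) t) \<longlongrightarrow> (1 - c) ^ t) F"
proof -
  have "((\<lambda>n. real (N n - M n - i) / real (N n - i)) \<longlongrightarrow> 1 - c) F" for i
  proof -
    have inv: "((\<lambda>n. real i / real (N n)) \<longlongrightarrow> 0) F"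
      by (rule real_tendsto_divide_at_top[OF tendsto_const
          filterlim_compose[OF filterlim_real_sequentially N]])
    have "((\<lambda>n. 1 - real (M n) / real (N n) - real i / real (N n)) \<longlongrightarrow> 1 - c - 0) F"
      by (intro tendsto_intros lim inv)
    \<comment> \<open>As \<open>1 - c > 0\<close>, the difference \<open>N n - M n - i\<close> is
      eventually untruncated.\<close>
    then have ev: "eventually (\<lambda>n. 1 - real (M n) / real (N n) - real i / real (N n) > 0) F"
      using c by (intro order_tendstoD(1)) auto
    have ev': "eventually (\<lambda>n. N n > i) F"
      using N eventually_compose_filterlim[OF eventually_gt_at_top N] by blast
    have "((\<lambda>n. (1 - real (M n) / real (N n) - real i / real (N n)) / (1 - real i / real (N n)))
        \<longlongrightarrow> (1 - c - 0) / (1 - 0)) F"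
      by (intro tendsto_intros lim inv) auto
    then have "((\<lambda>n. (1 - real (M n) / real (N n) - real i / real (N n)) / (1 - real i / real (N n)))
        \<longlongrightarrow> 1 - c) F" by simp
    then show ?thesis
    proof (rule Lim_transform_eventually)
      show "eventually (\<lambda>n. (1 - real (M n) / real (N n) - real i / real (N n)) /
          (1 - real i / real (N n)) = real (N n - M n - i) / real (N n - i)) F"
        using ev ev'
      proof eventually_elim
        case (elim n)
        have "real (N n) * (1 - real (M n) / real (N n) - real i / real (N n)) > 0"
          using elim by (intro mult_pos_pos) auto
        also have "real (N n) * (1 - real (M n) / real (N n) - real i / real (N n)) =
            real (N n) - real (M n) - real i"
          using elim by (simp add: algebra_simps)
        finally have "real (N n) - real (M n) - real i > 0" .
        then have "real (N n - M n - i) = real (N n) - real (M n) - real i"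
          by linarith
        with elim show ?case by (simp add: field_simps of_nat_diff)
      qed
    qed
  qed
  then have "((\<lambda>n. avoid_prob (N n) (M n) t) \<longlongrightarrow> (\<Prod>i<t. 1 - c)) F"
    unfolding avoid_prob_def by (intro tendsto_prod)
  then show ?thesis by simp
qed

section \<open>Counting permutations by a condition on their first entries\<close>

text \<open>The marked items are those violating \<open>P\<close>. Induction on \<open>M\<close>
  strips the first entry \<open>x\<close>, weighted by its multiplicity; the weights of the
  admissible \<open>x\<close> add up to the number of unmarked items, and
  \<open>avoid_prob_Suc\<close> absorbs the resulting ratio.\<close>

lemma card_permutations_of_multiset_take:
  assumes "M \<le> size A"
  shows "real (card {xs \<in> permutations_of_multiset A. \<forall>x\<in>set (take M xs). P x}) =
    real (card (permutations_of_multiset A)) *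
    avoid_prob (size A) M (size (filter_mset (\<lambda>x. \<not> P x) A))"
  using assms
proof (induction M arbitrary: A)
  case 0
  \<comment> \<open>For \<open>M = 0\<close> each factor has equal numerator and denominator; it is
    1 rather than 0 / 0 because \<open>i < size A\<close>.\<close>
  have "i < size A" if "i < size (filter_mset (\<lambda>x. \<not> P x) A)" for i
    using that size_filter_mset_lesseq[of "\<lambda>x. \<not> P x" A] by linarith
  then show ?case by (auto simp: avoid_prob_def not_le intro!: prod.neutral)
next
  case (Suc M)
  define t where "t = size (filter_mset (\<lambda>x. \<not> P x) A)"
  define c where "c = real (card (permutations_of_multiset A))"
  define S where "S = {x \<in> set_mset A. P x}"
  define E where "E B = {xs \<in> permutations_of_multiset B. \<forall>x\<in>set (take M xs). P x}" for B
  have "A \<noteq> {#}" using Suc.prems by auto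
  have tle: "t \<le> size A"
    by (simp add: size_filter_mset_lesseq t_def)
  have "{xs \<in> permutations_of_multiset A. \<forall>x\<in>set (take (Suc M) xs). P x} =
      (\<Union>x\<in>S. (#) x ` E (A - {#x#}))"
    using \<open>A \<noteq> {#}\<close> by (auto simp: permutations_of_multiset_nonempty S_def E_def)
  also have "card \<dots> = (\<Sum>x\<in>S. card (E (A - {#x#})))"
    by (subst card_UN_disjoint) (auto simp: card_image S_def E_def)
  also have "real \<dots> = (\<Sum>x\<in>S. c * avoid_prob (size A - 1) M t / real (size A) * real (count A x))"
    unfolding of_nat_sum
  proof (rule sum.cong)
    fix x assume x: "x \<in> S"
    then have "x \<in># A" "P x" by (auto simp: S_def)
    then have sz: "size (A - {#x#}) = size A - 1" by (simp add: size_Diff_singleton)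
    \<comment> \<open>Removing an unmarked entry keeps the number \<open>t\<close> of marked ones,
      so the induction hypothesis gives the same probability for every \<open>x\<close>.\<close>
    have "filter_mset (\<lambda>x. \<not> P x) (A - {#x#}) = filter_mset (\<lambda>x. \<not> P x) A"
      using \<open>P x\<close> by simp
    then show "real (card (E (A - {#x#}))) =
        c * avoid_prob (size A - 1) M t / real (size A) * real (count A x)"
      using Suc.IH[of "A - {#x#}"] Suc.prems sz
      by (simp add: E_def c_def t_def real_card_permutations_of_multiset_remove[OF \<open>x \<in># A\<close>])
  qed simp
  also have "\<dots> = c * avoid_prob (size A - 1) M t / real (size A) * real (\<Sum>x\<in>S. count A x)"
    by (simp add: sum_distrib_left)
  also have "(\<Sum>x\<in>S. count A x) = size (filter_mset P A)"
    by (auto simp: size_multiset_overloaded_eq S_def intro!: sum.cong)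
  also have "\<dots> = size A - t"
    unfolding t_def using multiset_partition[of A P] by (metis diff_add_inverse2 size_union)
  also have "c * avoid_prob (size A - 1) M t / real (size A) * real (size A - t) =
      c * avoid_prob (size A) (Suc M) t"
    using \<open>A \<noteq> {#}\<close> by (simp only: avoid_prob_Suc[OF tle] nonempty_has_size) (simp add: mult_ac)
  finally show ?case unfolding c_def t_def .
qed

section \<open>Arrangements and their symmetry under swapping ranks\<close>

lemma size_filter_mset_sum_replicate:
  assumes "finite R"
  shows "size (filter_mset P (\<Sum>r\<in>R. replicate_mset k r)) = k * card {r \<in> R. P r}"
  using assms
proof (induction R)
  case (insert x R)
  have "{r \<in> insert x R. P r} = (if P x then insert x {r \<in> R. P r} else {r \<in> R. P r})" by auto
  moreover have "filter_mset P (replicate_mset k x) = (if P x then replicate_mset k x else {#})"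
    by (induction k) auto
  ultimately show ?case using insert by simp
qed simp

lemma image_mset_sum_replicate:
  assumes "finite R"
  shows "image_mset f (\<Sum>r\<in>R. replicate_mset k r) = (\<Sum>r\<in>R. replicate_mset k (f r))"
  using assms by (induction R) auto

lemma arrangements_eq_permutations:
  "arrangements n k = permutations_of_multiset (\<Sum>r\<in>{1..n}. replicate_mset k r)"
  by (simp add: arrangements_def permutations_of_multiset_def)

lemma finite_arrangements [simp]: "finite (arrangements n k)"
  by (simp add: arrangements_eq_permutations)

lemma card_arrangements_pos: "card (arrangements n k) > 0"
  by (simp add: arrangements_eq_permutations card_gt_0_iff)

lemma length_arrangements:
  assumes "xs \<in> arrangements n k"
  shows "length xs = k * n"
proof -
  have "length xs = size (\<Sum>r\<in>{1..n}. replicate_mset k r)"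
    using assms by (simp add: arrangements_eq_permutations length_finite_permutations_of_multiset)
  then show ?thesis
    using size_filter_mset_sum_replicate[of "{1..n}" "\<lambda>_. True" k] by simp
qed

lemma set_arrangements:
  assumes "xs \<in> arrangements n k" "k > 0"
  shows "set xs = {1..n}"
proof -
  have "set_mset (\<Sum>r\<in>R. replicate_mset k r) = R" if "finite R" for R :: "nat set"
    using that \<open>k > 0\<close> by (induction R) auto
  then show ?thesis
    using assms by (simp add: arrangements_def flip: set_mset_mset)
qed

text \<open>All ranks occur equally often, so swapping two of them preserves the multiset of
  items.\<close>

lemma map_transpose_arrangements:
  assumes "xs \<in> arrangements n k" "a \<in> {1..n}" "b \<in> {1..n}"
  shows "map (Transposition.transpose a b) xs \<in> arrangements n k"
proof -
  have "bij_betw (Transposition.transpose a b) {1..n} {1..n}"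
    using assms by (simp add: permutes_imp_bij permutes_swap_id)
  then have "(\<Sum>r\<in>{1..n}. replicate_mset k (Transposition.transpose a b r)) = (\<Sum>r\<in>{1..n}. replicate_mset k r)"
    by (rule sum.reindex_bij_betw)
  then show ?thesis
    using assms by (simp add: arrangements_def image_mset_sum_replicate)
qed

section \<open>Exchangeability of the ranks above the observed maximum\<close>

lemma find_map_invariant:
  assumes "\<And>x. P (f x) = P x"
  shows "find P (map f xs) = map_option f (find P xs)"
  by (induction xs) (auto simp: assms)

text \<open>By symmetry each of the \<open>n - m\<close> ranks above \<open>m\<close> is equally
  often the first one found, and one is always found.\<close>

lemma card_find_top_eq:
  assumes M: "0 < M" "M < k * n" and "m < n"
  shows "(n - m) * card {xs \<in> arrangements n k. Max (set (take M xs)) = m \<and>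
      find (\<lambda>r. r > m) (drop M xs) = Some n} =
    card {xs \<in> arrangements n k. Max (set (take M xs)) = m}"
proof -
  define E where "E r = {xs \<in> arrangements n k. Max (set (take M xs)) = m \<and>
      find (\<lambda>r. r > m) (drop M xs) = Some r}" for r
  have "k > 0" using M by (cases k) auto
  \<comment> \<open>Swapping two ranks above \<open>m\<close> fixes the first \<open>M\<close>
    items, all of rank at most \<open>m\<close>, and preserves being above \<open>m\<close>; the
    same position is selected and only its rank is relabelled.\<close>
  have swap: "map (Transposition.transpose a b) xs \<in> E (Transposition.transpose a b r)"
    if "xs \<in> E r" "a \<in> {m<..n}" "b \<in> {m<..n}" for xs r a b
  proof -
    let ?f = "Transposition.transpose a b"
    have xs: "xs \<in> arrangements n k" and max: "Max (set (take M xs)) = m"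
      and fd: "find (\<lambda>r. r > m) (drop M xs) = Some r"
      using that(1) by (auto simp: E_def)
    have "x \<le> m" if "x \<in> set (take M xs)" for x
      using that max by auto
    then have "map ?f (take M xs) = take M xs"
      using that(2,3) by (intro map_idI) (force intro!: transpose_apply_other)
    then have tk: "take M (map ?f xs) = take M xs" by (simp add: take_map)
    have "(?f x > m) = (x > m)" for x
      using that(2,3) by (auto simp: Transposition.transpose_def)
    then have "find (\<lambda>r. r > m) (map ?f (drop M xs)) = Some (?f r)"
      using find_map_invariant[of "\<lambda>r. r > m" ?f] fd by simp
    then show ?thesis
      using tk max xs that(2,3) by (simp add: E_def map_transpose_arrangements drop_map)
  qed
  have card_eq: "card (E r) = card (E n)" if "r \<in> {m<..n}" for r
  proof (rule bij_betw_same_card)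
    have "n \<in> {m<..n}" using \<open>m < n\<close> by simp
    show "bij_betw (map (Transposition.transpose r n)) (E r) (E n)"
    \<comment> \<open>A transposition is its own inverse.\<close>
    proof (rule bij_betw_byWitness[where f' = "map (Transposition.transpose r n)"])
      show "map (Transposition.transpose r n) ` E r \<subseteq> E n"
        using swap[of _ r r n] that \<open>n \<in> {m<..n}\<close> by auto
      show "map (Transposition.transpose r n) ` E n \<subseteq> E r"
        using swap[of _ n r n] that \<open>n \<in> {m<..n}\<close> by auto
    qed simp_all
  qed
  have "{xs \<in> arrangements n k. Max (set (take M xs)) = m} = (\<Union>r\<in>{m<..n}. E r)"
  proof (intro equalityI subsetI)
    fix xs assume "xs \<in> {xs \<in> arrangements n k. Max (set (take M xs)) = m}"
    then have xs: "xs \<in> arrangements n k" and max: "Max (set (take M xs)) = m" by auto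
    have st: "set xs = {1..n}" using set_arrangements[OF xs \<open>k > 0\<close>] .
    \<comment> \<open>The search cannot fail: rank \<open>n\<close> occurs, but not among the first
      \<open>M\<close> items, whose maximum is \<open>m < n\<close>.\<close>
    then have "n \<in> set (take M xs @ drop M xs)"
      using \<open>m < n\<close> by simp
    then have "n \<in> set (take M xs) \<union> set (drop M xs)"
      unfolding set_append .
    moreover have "n \<notin> set (take M xs)"
      using max \<open>m < n\<close> Max_ge[of "set (take M xs)" n] by auto
    ultimately have "n \<in> set (drop M xs)" by blast
    then obtain r where r: "find (\<lambda>r. r > m) (drop M xs) = Some r"
      using \<open>m < n\<close> by (metis find_None_iff not_None_eq)
    then have "r \<in> set (drop M xs)" "r > m"
      by (auto simp: find_Some_iff simp del: nth_drop)
    then have "r \<in> {m<..n}" using st in_set_dropD[of r M xs] by auto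
    with r xs max show "xs \<in> (\<Union>r\<in>{m<..n}. E r)" by (auto simp: E_def)
  qed (auto simp: E_def)
  also have "card \<dots> = (\<Sum>r\<in>{m<..n}. card (E r))"
    by (subst card_UN_disjoint) (auto simp: E_def)
  also have "\<dots> = (\<Sum>r\<in>{m<..n}. card (E n))"
    by (rule sum.cong[OF refl card_eq])
  also have "\<dots> = (n - m) * card (E n)"
    by simp
  finally show ?thesis by (simp add: E_def)
qed

section \<open>Exact formula for the success probability\<close>

text \<open>Mark the \<open>k * (n - m)\<close> items of rank above \<open>m\<close>: the maximum
  stays at most \<open>m\<close> exactly when they all miss the first \<open>M\<close>
  positions.\<close>

lemma card_arrangements_Max_take_le:
  assumes M: "0 < M" "M < k * n"
  shows "real (card {xs \<in> arrangements n k. Max (set (take M xs)) \<le> m}) =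
    real (card (arrangements n k)) * avoid_prob (k * n) M (k * (n - m))"
proof -
  let ?A = "\<Sum>r\<in>{1..n}. replicate_mset k r"
  have sz: "size ?A = k * n"
    using size_filter_mset_sum_replicate[of "{1..n}" "\<lambda>_. True" k] by simp
  have "{r \<in> {1..n}. \<not> r \<le> m} = {m<..n}" by auto
  then have fl: "size (filter_mset (\<lambda>r. \<not> r \<le> m) ?A) = k * (n - m)"
    using size_filter_mset_sum_replicate[of "{1..n}" "\<lambda>r. \<not> r \<le> m" k] by simp
  have "{xs \<in> arrangements n k. Max (set (take M xs)) \<le> m} =
      {xs \<in> arrangements n k. \<forall>x\<in>set (take M xs). x \<le> m}"
  proof (rule Collect_cong, rule conj_cong[OF refl])
    fix xs assume "xs \<in> arrangements n k"
    then have "take M xs \<noteq> []" using M length_arrangements by force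
    then show "(Max (set (take M xs)) \<le> m) = (\<forall>x\<in>set (take M xs). x \<le> m)"
      by (subst Max_le_iff) auto
  qed
  then show ?thesis
    using card_permutations_of_multiset_take[of M ?A "\<lambda>r. r \<le> m"] M
    unfolding arrangements_eq_permutations sz fl by simp
qed

lemma P_splus_eq:
  assumes M: "0 < M" "M < k * n"
  shows "P_splus n k M = (\<Sum>j\<in>{1..<n}.
    (avoid_prob (k * n) M (k * j) - avoid_prob (k * n) M (k * Suc j)) / real j)"
proof -
  define c where "c = real (card (arrangements n k))"
  have "c > 0" using card_arrangements_pos by (simp add: c_def)
  have "k > 0" using M by (cases k) auto
  define E where "E m = {xs \<in> arrangements n k. Max (set (take M xs)) = m \<and>
      find (\<lambda>r. r > m) (drop M xs) = Some n}" for m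
  \<comment> \<open>The observed maximum \<open>m\<close> is a rank, hence at least 1, and selecting
    \<open>n\<close> forces \<open>m < n\<close>.\<close>
  have "{xs \<in> arrangements n k. splus_succeeds n M xs} = (\<Union>m\<in>{1..<n}. E m)"
  proof (intro equalityI subsetI)
    fix xs assume "xs \<in> {xs \<in> arrangements n k. splus_succeeds n M xs}"
    then have xs: "xs \<in> arrangements n k"
      and fd: "find (\<lambda>r. r > Max (set (take M xs))) (drop M xs) = Some n"
      by (auto simp: splus_succeeds_def)
    have "take M xs \<noteq> []" using M length_arrangements[OF xs] by force
    then have "Max (set (take M xs)) \<in> set (take M xs)" by (intro Max_in) auto
    then have "Max (set (take M xs)) \<in> {1..n}"
      unfolding set_arrangements[OF xs \<open>k > 0\<close>, symmetric] by (rule in_set_takeD)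
    moreover have "n > Max (set (take M xs))" using fd by (auto simp: find_Some_iff)
    ultimately show "xs \<in> (\<Union>m\<in>{1..<n}. E m)" using xs fd by (auto simp: E_def)
  qed (auto simp: E_def splus_succeeds_def)
  also have "card \<dots> = (\<Sum>m\<in>{1..<n}. card (E m))"
    by (subst card_UN_disjoint) (auto simp: E_def)
  finally have "P_splus n k M = (\<Sum>m\<in>{1..<n}. real (card (E m)) / c)"
    by (simp add: P_splus_def c_def sum_divide_distrib)
  also have "\<dots> = (\<Sum>m\<in>{1..<n}. (avoid_prob (k * n) M (k * (n - m)) -
      avoid_prob (k * n) M (k * Suc (n - m))) / real (n - m))"
  proof (rule sum.cong)
    fix m assume m: "m \<in> {1..<n}"
    \<comment> \<open>As \<open>1 <= m\<close>, \<open>m - 1\<close> is a genuine predecessor;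
      lowering the bound to it adds one more top rank to be avoided.\<close>
    then have diff_pred: "n - (m - 1) = Suc (n - m)" by auto
    let ?L = "\<lambda>m. {xs \<in> arrangements n k. Max (set (take M xs)) \<le> m}"
    have split: "{xs \<in> arrangements n k. Max (set (take M xs)) = m} = ?L m - ?L (m - 1)"
      using m by auto
    have sub: "?L (m - 1) \<subseteq> ?L m" by auto
    have fin: "finite (?L i)" for i by simp
    have "real (card {xs \<in> arrangements n k. Max (set (take M xs)) = m}) =
        real (card (?L m)) - real (card (?L (m - 1)))"
      unfolding split card_Diff_subset[OF fin sub] by (rule of_nat_diff[OF card_mono[OF fin sub]])
    also have "\<dots> = c * (avoid_prob (k * n) M (k * (n - m)) - avoid_prob (k * n) M (k * Suc (n - m)))"
      unfolding card_arrangements_Max_take_le[OF M] c_def diff_pred right_diff_distrib by simp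
    finally have "real (n - m) * real (card (E m)) =
        c * (avoid_prob (k * n) M (k * (n - m)) - avoid_prob (k * n) M (k * Suc (n - m)))"
      using card_find_top_eq[OF M, of m] m unfolding E_def of_nat_mult[symmetric] by simp
    then show "real (card (E m)) / c = (avoid_prob (k * n) M (k * (n - m)) -
      avoid_prob (k * n) M (k * Suc (n - m))) / real (n - m)"
      using \<open>c > 0\<close> m by (simp add: divide_eq_eq eq_divide_eq mult_ac)
  qed simp
  also have "\<dots> = (\<Sum>j\<in>{1..<n}.
      (avoid_prob (k * n) M (k * j) - avoid_prob (k * n) M (k * Suc j)) / real j)"
    by (rule sum.reindex_bij_witness[of _ "\<lambda>j. n - j" "\<lambda>j. n - j"]) auto
  finally show ?thesis .
qed

section \<open>Passage to the limit\<close>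

text \<open>Each term is \<open>(1 - q) * q ^ j / j\<close>, so this is the series of
  \<open>ln (1 - q)\<close> scaled by \<open>- (1 - q)\<close>; the term at \<open>j = 0\<close> is
  0 by division by zero.\<close>

lemma sums_log_geometric:
  fixes q :: real
  assumes "0 < q" "q < 1"
  shows "(\<lambda>j. (q ^ j - q ^ Suc j) / real j) sums (- (1 - q) * ln (1 - q))"
proof -
  have "(\<lambda>j. - (q ^ j) / real j) sums ln (1 - q)"
    using ln_series'[of "- q"] assms by simp
  then have "(\<lambda>j. - (1 - q) * (- (q ^ j) / real j)) sums (- (1 - q) * ln (1 - q))"
    by (rule sums_mult)
  then show ?thesis
    by (simp add: algebra_simps diff_divide_distrib)
qed

theorem theorem2:
  fixes k :: nat and c :: real and Ms :: "nat \<Rightarrow> nat"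
  assumes "k \<ge> 2"
    and "0 < c" and "c < 1"
    and "\<And>n. n \<ge> 1 \<Longrightarrow> 1 \<le> Ms n \<and> Ms n \<le> k * n - 1"
    and "(\<lambda>n. real (Ms n) / real (k * n)) \<longlonglongrightarrow> c"
  shows "(\<lambda>n. P_splus n k (Ms n)) \<longlonglongrightarrow> - (1 - (1 - c) ^ k) * ln (1 - (1 - c) ^ k)"
proof -
  define q where "q = (1 - c) ^ k"
  define Q where "Q n j = avoid_prob (k * n) (Ms n) (k * j)" for n j
  \<comment> \<open>Extension by zero turns sums of varying length into series over all
    \<open>j\<close>, as Tannery's theorem requires.\<close>
  define a where "a j n = (if j \<in> {1..<n} then (Q n j - Q n (Suc j)) / real j else 0)" for j n
  have q: "0 < q" "q < 1"
    using assms(1-3) by (auto simp: q_def power_less_one_iff)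
  \<comment> \<open>The margin \<open>c / 2\<close> is eventually exceeded by
    \<open>Ms n / (k * n)\<close>, whereas \<open>c\<close> itself need not be; hence a dominating
    ratio \<open>b\<close> slightly weaker than \<open>q\<close>.\<close>
  define b where "b = (1 - c / 2) ^ k"
  have b: "0 < b" "b < 1"
    using assms(1-3) by (auto simp: b_def power_less_one_iff)
  have N: "filterlim (\<lambda>n. k * n) at_top sequentially"
    using assms(1) by (intro filterlim_subseq) (auto simp: strict_mono_def)
  have lim: "(\<lambda>n. a j n) \<longlonglongrightarrow> (q ^ j - q ^ Suc j) / real j" for j
  proof (cases "j = 0")
    case False
    have Q: "(\<lambda>n. Q n i) \<longlonglongrightarrow> q ^ i" for i
      unfolding Q_def q_def power_mult[symmetric]
      by (rule tendsto_avoid_prob[OF N assms(5,3)])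
    have "(\<lambda>n. (Q n j - Q n (Suc j)) / real j) \<longlonglongrightarrow> (q ^ j - q ^ Suc j) / real j"
      using False by (intro tendsto_intros Q) auto
    then show ?thesis
    proof (rule Lim_transform_eventually)
      show "eventually (\<lambda>n. (Q n j - Q n (Suc j)) / real j = a j n) sequentially"
        using eventually_gt_at_top[of j] by eventually_elim (use False in \<open>auto simp: a_def\<close>)
    qed
  qed (simp add: a_def)
  have "eventually (\<lambda>n. real (Ms n) / real (k * n) > c / 2) sequentially"
    using assms(2) by (intro order_tendstoD(1)[OF assms(5)]) auto
  then have "eventually (\<lambda>n. \<forall>j. norm (a j n) \<le> b ^ j) sequentially"
    using eventually_gt_at_top[of 0]
  proof eventually_elim
    case (elim n)
    have Mn: "Ms n \<le> k * n" "k * n > 0" using assms(4)[of n] elim assms(1) by auto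
    show ?case
    proof
      fix j
      show "norm (a j n) \<le> b ^ j"
      proof (cases "j \<in> {1..<n}")
        case True
        have le: "Q n (Suc j) \<le> Q n j" and "0 \<le> Q n (Suc j)"
          unfolding Q_def by (intro avoid_prob_antimono avoid_prob_nonneg; simp)+
        have "norm (a j n) = (Q n j - Q n (Suc j)) / real j"
          using True le by (simp add: a_def)
        also have "\<dots> \<le> (Q n j - Q n (Suc j)) / 1"
          using True le by (intro divide_left_mono) auto
        also have "\<dots> \<le> Q n j" using \<open>0 \<le> Q n (Suc j)\<close> by simp
        also have "\<dots> \<le> (real (k * n - Ms n) / real (k * n)) ^ (k * j)"
          unfolding Q_def using True by (intro avoid_prob_le_power) auto
        also have "real (k * n - Ms n) / real (k * n) = 1 - real (Ms n) / real (k * n)"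
          using Mn by (simp add: of_nat_diff diff_divide_distrib del: of_nat_mult)
        also have "\<dots> ^ (k * j) \<le> (1 - c / 2) ^ (k * j)"
          using elim Mn by (intro power_mono) (auto simp del: of_nat_mult)
        finally show ?thesis by (simp add: b_def power_mult)
      next
        case False
        then have "a j n = 0" unfolding a_def by (rule if_not_P)
        then show ?thesis using b by simp
      qed
    qed
  qed
  \<comment> \<open>The bound is uniform in \<open>j\<close>, so only \<open>n\<close> has to be
    large.\<close>
  then have bound: "eventually (\<lambda>(j, n). norm (a j n) \<le> b ^ j) (at_top \<times>\<^sub>F sequentially)"
    unfolding eventually_prod_filter by (intro exI[of _ "\<lambda>_. True"] exI conjI) auto
  have "(\<lambda>n. suminf (\<lambda>j. a j n)) \<longlonglongrightarrow> (\<Sum>j. (q ^ j - q ^ Suc j) / real j)"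
    using tannerys_theorem[OF lim bound] b by (auto simp: summable_geometric)
  also have "(\<Sum>j. (q ^ j - q ^ Suc j) / real j) = - (1 - q) * ln (1 - q)"
    using sums_log_geometric[OF q] by (simp add: sums_iff)
  finally show ?thesis
    unfolding q_def
  proof (rule Lim_transform_eventually)
    show "eventually (\<lambda>n. suminf (\<lambda>j. a j n) = P_splus n k (Ms n)) sequentially"
      using eventually_gt_at_top[of 0]
    proof eventually_elim
      case (elim n)
      have "suminf (\<lambda>j. a j n) = (\<Sum>j\<in>{1..<n}. a j n)"
        by (rule suminf_finite) (auto simp: a_def)
      also have "\<dots> = P_splus n k (Ms n)"
      proof -
        \<comment> \<open>Positivity turns the truncated bound \<open>Ms n <= k * n - 1\<close> into
          a strict inequality.\<close>
        have "k * n > 0" using elim assms(1) by simp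
        then have "0 < Ms n" "Ms n < k * n" using assms(4)[of n] elim by auto
        then show ?thesis by (simp add: P_splus_eq a_def Q_def)
      qed
      finally show ?case .
    qed
  qed
qed

end
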